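(* Let $\mathcal L$ be a positive definite linear functional on $\prod^{N,M}$, and for $0\le n\le N$, $0\le m\le M$ let the coefficient matrices be as defined in the context. Then $$\tilde{\mathcal K}_{n,m}=\mathcal K_{n,m}^\dagger,\quad \tilde I_{n,m}=I_{n,m}^\dagger,\quad \tilde I^1_{n,m}=(I^1_{n,m})^T,\quad \tilde{\mathcal K}^1_{n,m}=(\mathcal K^1_{n,m})^T.$$ Also $$A_{n,m}A_{n,m}^\dagger=I_{m+1}-\hat E_{n,m}\hat E_{n,m}^\dagger\quad(n\ge1),$$ $$\Gamma_{n,m}\Gamma_{n,m}^\dagger=I_m-\mathcal K_{n,m}\mathcal K_{n,m}^\dagger,$$ $$\Gamma^1_{n,m}(\Gamma^1_{n,m})^\dagger=I_m-\mathcal K^1_{n,m}(\mathcal K^1_{n,m})^\dagger,$$ $$I_{n,m}I_{n,m}^\dagger+\Gamma_{n,m}^\dagger\Gamma_{n,m}=I_{m+1},$$ $$I^1_{n,m}(I^1_{n,m})^\dagger+(\Gamma^1_{n,m})^T\,\overline{\Gamma^1_{n,m}}=I_{m+1}.$$ Here $I_m$, $I_{m+1}$ with one index denote identity matrices.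
   Context: $\prod^{N,M}=\mathrm{span}\{z^iw^j:|i|\le N,|j|\le M\}$, $\hat\prod^{N,M}=\mathrm{span}\{z^iw^j:0\le i\le N,0\le j\le M\}$. For a (matrix valued) Laurent polynomial $Q$, $Q^\dagger(z,w)=Q(1/\bar z,1/\bar w)^\dagger$. A linear functional $\mathcal L$ on $\prod^{N,M}$ with $\mathcal L(z^{-i}w^{-j})=\overline{\mathcal L(z^iw^j)}$ is positive definite if $\mathcal L(pp^\dagger)>0$ for all nonzero $p\in\hat\prod^{N,M}$. It is applied entrywise and, for column vectors, $\langle X,Y\rangle=\mathcal L(XY^\dagger)$. Bars on matrices are entrywise conjugates. For $0\le l\le m$, $\phi^l_{n,m}$ is the unique element of $\mathrm{span}(\{z^iw^j:0\le i<n,0\le j\le m\}\cup\{z^nw^j:0\le j\le l\})$ with positive coefficient of $z^nw^l$, $\langle\phi^l_{n,m},\phi^l_{n,m}\rangle=1$, orthogonal to all of these monomials except $z^nw^l$; $\Phi_{n,m}=[\phi^m_{n,m},\dots,\phi^0_{n,m}]^T$. For $0\le l\le n$, $\tilde\phi^l_{n,m}$ is the unique element of $\mathrm{span}(\{z^iw^j:0\le i\le n,0\le j<m\}\cup\{z^iw^m:0\le i\le l\})$ with positive coefficient of $z^lw^m$, norm one, orthogonal to all of these monomials except $z^lw^m$; $\tilde\Phi_{n,m}=[\tilde\phi^n_{n,m},\dots,\tilde\phi^0_{n,m}]^T$. Reversals are the row vectors $\overleftarrow\Phi_{n,m}(z,w)=z^nw^m\Phi_{n,m}(1/\bar z,1/\bar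 w)^\dagger$, $\overleftarrow{\tilde\Phi}_{n,m}(z,w)=z^nw^m\tilde\Phi_{n,m}(1/\bar z,1/\bar w)^\dagger$. $\Phi_{n,-1}$ and $\tilde\Phi_{-1,m}$ are empty; matrices with zero rows or columns are empty (products over an empty index are zero). Coefficients: $\hat E_{n,m}=\langle z\Phi_{n-1,m},\overleftarrow\Phi_{n-1,m}^T\rangle$, $A_{n,m}=\langle z\Phi_{n-1,m},\Phi_{n,m}\rangle$ ($n\ge1$), $\mathcal K_{n,m}=\langle\Phi_{n,m-1},\tilde\Phi_{n-1,m}\rangle$, $\Gamma_{n,m}=\langle\Phi_{n,m-1},\Phi_{n,m}\rangle$, $\mathcal K^1_{n,m}=\langle w\Phi_{n,m-1},\overleftarrow{\tilde\Phi}_{n-1,m}^T\rangle$, $\Gamma^1_{n,m}=\langle w\Phi_{n,m-1},\Phi_{n,m}\rangle$, $I_{n,m}=\langle\Phi_{n,m},\tilde\Phi_{n,m}\rangle$, $I^1_{n,m}=\langle\overleftarrow\Phi_{n,m}^T,\tilde\Phi_{n,m}\rangle$; and, with the orderings interchanged, $\tilde{\mathcal K}_{n,m}=\langle\tilde\Phi_{n-1,m},\Phi_{n,m-1}\rangle$, $\tilde{\mathcal K}^1_{n,m}=\langle z\tilde\Phi_{n-1,m},\overleftarrow\Phi_{n,m-1}^T\rangle$, $\tilde I_{n,m}=\langle\tilde\Phi_{n,m},\Phi_{n,m}\rangle$, $\tilde I^1_{n,m}=\langle\overleftarrow{\tilde\Phi}_{n,m}^T,\Phi_{n,m}\rangle$.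 *)

theory Defs
  imports
    "Jordan_Normal_Form.Schur_Decomposition"
    "HOL-Library.Poly_Mapping"
    "HOL-Library.Product_Plus"
begin

section \<open>Laurent polynomials in two variables\<close>

text \<open>The key \<open>(i, j)\<close> carries the coefficient of \<open>z\<^sup>i w\<^sup>j\<close>; since multiplication of
  \<open>poly_mapping\<close> is convolution over the additive group of the keys, this is the ring of
  complex Laurent polynomials in \<open>z, w\<close>.\<close>

type_synonym laurent = "(int \<times> int) \<Rightarrow>\<^sub>0 complex"

definition lmono :: "int \<Rightarrow> int \<Rightarrow> laurent" where
  "lmono i j = Poly_Mapping.single (i, j) 1"

definition lscale :: "complex \<Rightarrow> laurent \<Rightarrow> laurent" where
  "lscale c p = Poly_Mapping.single 0 c * p"

global_interpretation laurent: Vector_Spaces.vector_space lscale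
  defines lspan = laurent.span
proof
  fix a b :: complex and x y :: laurent
  show "lscale a (x + y) = lscale a x + lscale a y"
    by (simp add: lscale_def distrib_left)
  show "lscale (a + b) x = lscale a x + lscale b x"
    by (simp add: lscale_def single_add distrib_right)
  show "lscale a (lscale b x) = lscale (a * b) x"
    by (simp add: lscale_def mult_single flip: mult.assoc)
  show "lscale 1 x = x"
    by (simp add: lscale_def)
qed

definition lspan_of :: "(int \<times> int) set \<Rightarrow> laurent set" where
  "lspan_of S = lspan ((\<lambda>(i, j). lmono i j) ` S)"

definition Pi_sym :: "int \<Rightarrow> int \<Rightarrow> laurent set" where
  "Pi_sym N M = lspan_of ({- N..N} \<times> {- M..M})"

definition Pi_hat :: "int \<Rightarrow> int \<Rightarrow> laurent set" where
  "Pi_hat N M = lspan_of ({0..N} \<times> {0..M})"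

text \<open>\<open>p\<^sup>\<dagger>(z,w)\<close> is the conjugate of \<open>p(1/cnj z, 1/cnj w)\<close>, so the coefficient of
  \<open>z\<^sup>i w\<^sup>j\<close> in \<open>p\<^sup>\<dagger>\<close> is the conjugate of that of \<open>z\<^bsup>-i\<^esup> w\<^bsup>-j\<^esup>\<close> in \<open>p\<close>.\<close>

lift_definition ldagger :: "laurent \<Rightarrow> laurent" is "\<lambda>c k. cnj (c (- k))"
proof -
  fix c :: "int \<times> int \<Rightarrow> complex"
  assume "finite {k. c k \<noteq> 0}"
  then have "finite (uminus ` {k. c k \<noteq> 0})" by (rule finite_imageI)
  moreover have "{k. cnj (c (- k)) \<noteq> 0} \<subseteq> uminus ` {k. c k \<noteq> 0}"
  proof
    fix k assume "k \<in> {k. cnj (c (- k)) \<noteq> 0}"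
    then have "- k \<in> {k. c k \<noteq> 0}" "k = - (- k)" by auto
    then show "k \<in> uminus ` {k. c k \<noteq> 0}" by blast
  qed
  ultimately show "finite {k. cnj (c (- k)) \<noteq> 0}" by (rule rev_finite_subset)
qed

definition lmat_dagger :: "laurent mat \<Rightarrow> laurent mat" where
  "lmat_dagger Q = transpose_mat (map_mat ldagger Q)"

section \<open>Positive definite functionals\<close>

definition cpos :: "complex \<Rightarrow> bool" where
  "cpos c \<longleftrightarrow> c \<in> \<real> \<and> Re c > 0"

text \<open>A functional on \<open>Pi_sym N M\<close> is a function on all Laurent polynomials whose values
  outside \<open>Pi_sym N M\<close> are unconstrained.\<close>

definition pos_def_functional :: "int \<Rightarrow> int \<Rightarrow> (laurent \<Rightarrow> complex) \<Rightarrow> bool" where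
  "pos_def_functional N M L \<longleftrightarrow>
     (\<forall>p\<in>Pi_sym N M. \<forall>q\<in>Pi_sym N M. L (p + q) = L p + L q) \<and>
     (\<forall>c. \<forall>p\<in>Pi_sym N M. L (lscale c p) = c * L p) \<and>
     (\<forall>i\<in>{- N..N}. \<forall>j\<in>{- M..M}. L (lmono (- i) (- j)) = cnj (L (lmono i j))) \<and>
     (\<forall>p\<in>Pi_hat N M. p \<noteq> 0 \<longrightarrow> cpos (L (p * ldagger p)))"

text \<open>Column vectors are one-column matrices.\<close>

definition linner :: "(laurent \<Rightarrow> complex) \<Rightarrow> laurent mat \<Rightarrow> laurent mat \<Rightarrow> complex mat" where
  "linner L X Y = map_mat L (X * lmat_dagger Y)"

section \<open>Orthonormal polynomials\<close>

definition is_orthonormal_poly ::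
    "(laurent \<Rightarrow> complex) \<Rightarrow> (int \<times> int) set \<Rightarrow> int \<times> int \<Rightarrow> laurent \<Rightarrow> bool" where
  "is_orthonormal_poly L S k p \<longleftrightarrow>
     p \<in> lspan_of S \<and> cpos (Poly_Mapping.lookup p k) \<and> L (p * ldagger p) = 1 \<and>
     (\<forall>(i, j)\<in>S - {k}. L (p * ldagger (lmono i j)) = 0)"

definition phi :: "(laurent \<Rightarrow> complex) \<Rightarrow> int \<Rightarrow> int \<Rightarrow> int \<Rightarrow> laurent" where
  "phi L n m l = (THE p. is_orthonormal_poly L ({0..<n} \<times> {0..m} \<union> {n} \<times> {0..l}) (n, l) p)"

definition tphi :: "(laurent \<Rightarrow> complex) \<Rightarrow> int \<Rightarrow> int \<Rightarrow> int \<Rightarrow> laurent" where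
  "tphi L n m l = (THE p. is_orthonormal_poly L ({0..n} \<times> {0..<m} \<union> {0..l} \<times> {m}) (l, m) p)"

text \<open>The prefix \<open>t\<close> stands for the tilde. \<open>Phi L n (- 1)\<close> and \<open>tPhi L (- 1) m\<close> have no rows.\<close>

definition Phi :: "(laurent \<Rightarrow> complex) \<Rightarrow> int \<Rightarrow> int \<Rightarrow> laurent mat" where
  "Phi L n m = mat (nat (m + 1)) 1 (\<lambda>(r, _). phi L n m (m - int r))"

definition tPhi :: "(laurent \<Rightarrow> complex) \<Rightarrow> int \<Rightarrow> int \<Rightarrow> laurent mat" where
  "tPhi L n m = mat (nat (n + 1)) 1 (\<lambda>(r, _). tphi L n m (n - int r))"

definition Phi_rev :: "(laurent \<Rightarrow> complex) \<Rightarrow> int \<Rightarrow> int \<Rightarrow> laurent mat" where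
  "Phi_rev L n m = lmono n m \<cdot>\<^sub>m lmat_dagger (Phi L n m)"

definition tPhi_rev :: "(laurent \<Rightarrow> complex) \<Rightarrow> int \<Rightarrow> int \<Rightarrow> laurent mat" where
  "tPhi_rev L n m = lmono n m \<cdot>\<^sub>m lmat_dagger (tPhi L n m)"

section \<open>Coefficient matrices\<close>

abbreviation z_var :: laurent where "z_var \<equiv> lmono 1 0"
abbreviation w_var :: laurent where "w_var \<equiv> lmono 0 1"

definition coeff_Ehat :: "(laurent \<Rightarrow> complex) \<Rightarrow> int \<Rightarrow> int \<Rightarrow> complex mat" where
  "coeff_Ehat L n m = linner L (z_var \<cdot>\<^sub>m Phi L (n - 1) m) (transpose_mat (Phi_rev L (n - 1) m))"

definition coeff_A :: "(laurent \<Rightarrow> complex) \<Rightarrow> int \<Rightarrow> int \<Rightarrow> complex mat" where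
  "coeff_A L n m = linner L (z_var \<cdot>\<^sub>m Phi L (n - 1) m) (Phi L n m)"

definition coeff_K :: "(laurent \<Rightarrow> complex) \<Rightarrow> int \<Rightarrow> int \<Rightarrow> complex mat" where
  "coeff_K L n m = linner L (Phi L n (m - 1)) (tPhi L (n - 1) m)"

definition coeff_Gamma :: "(laurent \<Rightarrow> complex) \<Rightarrow> int \<Rightarrow> int \<Rightarrow> complex mat" where
  "coeff_Gamma L n m = linner L (Phi L n (m - 1)) (Phi L n m)"

definition coeff_K1 :: "(laurent \<Rightarrow> complex) \<Rightarrow> int \<Rightarrow> int \<Rightarrow> complex mat" where
  "coeff_K1 L n m = linner L (w_var \<cdot>\<^sub>m Phi L n (m - 1)) (transpose_mat (tPhi_rev L (n - 1) m))"

definition coeff_Gamma1 :: "(laurent \<Rightarrow> complex) \<Rightarrow> int \<Rightarrow> int \<Rightarrow> complex mat" where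
  "coeff_Gamma1 L n m = linner L (w_var \<cdot>\<^sub>m Phi L n (m - 1)) (Phi L n m)"

definition coeff_I :: "(laurent \<Rightarrow> complex) \<Rightarrow> int \<Rightarrow> int \<Rightarrow> complex mat" where
  "coeff_I L n m = linner L (Phi L n m) (tPhi L n m)"

definition coeff_I1 :: "(laurent \<Rightarrow> complex) \<Rightarrow> int \<Rightarrow> int \<Rightarrow> complex mat" where
  "coeff_I1 L n m = linner L (transpose_mat (Phi_rev L n m)) (tPhi L n m)"

definition coeff_tK :: "(laurent \<Rightarrow> complex) \<Rightarrow> int \<Rightarrow> int \<Rightarrow> complex mat" where
  "coeff_tK L n m = linner L (tPhi L (n - 1) m) (Phi L n (m - 1))"

definition coeff_tK1 :: "(laurent \<Rightarrow> complex) \<Rightarrow> int \<Rightarrow> int \<Rightarrow> complex mat" where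
  "coeff_tK1 L n m = linner L (z_var \<cdot>\<^sub>m tPhi L (n - 1) m) (transpose_mat (Phi_rev L n (m - 1)))"

definition coeff_tI :: "(laurent \<Rightarrow> complex) \<Rightarrow> int \<Rightarrow> int \<Rightarrow> complex mat" where
  "coeff_tI L n m = linner L (tPhi L n m) (Phi L n m)"

definition coeff_tI1 :: "(laurent \<Rightarrow> complex) \<Rightarrow> int \<Rightarrow> int \<Rightarrow> complex mat" where
  "coeff_tI1 L n m = linner L (transpose_mat (tPhi_rev L n m)) (Phi L n m)"

end

theory Submission
  imports Defs
begin

text \<open>Each of the five matrix identities is a Parseval identity. If \<open>x\<close>, \<open>y\<close>, \<open>z\<close> are orthonormal
  families of polynomials with exponents in \<open>S\<close>, all orthogonal to the monomials with exponents in
  \<open>T \<subseteq> S\<close>, if \<open>y\<close> and \<open>z\<close> are mutually orthogonal, and if \<open>card S - card T\<close> is the total number of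
  elements of \<open>y\<close> and \<open>z\<close>, then \<open>y\<close> and \<open>z\<close> span the orthogonal complement of \<open>T\<close> in \<open>S\<close>, so
  that the Gram matrices satisfy
  \<open>\<langle>x, y\<rangle> \<langle>x, y\<rangle>\<^sup>\<dagger> + \<langle>x, z\<rangle> \<langle>x, z\<rangle>\<^sup>\<dagger> = \<langle>x, x\<rangle>\<close>, an identity matrix. The families are \<open>Phi\<close> and
  \<open>tPhi\<close>, their shifts by \<open>z\<close> or \<open>w\<close>, and their reversals; shifts and reversals preserve
  orthonormality and move \<open>S\<close> and \<open>T\<close> inside the rectangle of exponents.\<close>

section \<open>Laurent polynomials with prescribed exponents\<close>

lemma poly_mapping_eq_sum_single:
  fixes p :: "'a \<Rightarrow>\<^sub>0 'b::comm_monoid_add"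
  shows "p = (\<Sum>k\<in>Poly_Mapping.keys p. Poly_Mapping.single k (Poly_Mapping.lookup p k))"
  by (rule poly_mapping_eqI)
    (auto simp: lookup_sum lookup_single when_def in_keys_iff sum.delta)

text \<open>A Laurent polynomial is a finite sum of single terms, so an additive property need only
  be checked on terms. This serves for identities such as \<open>ldagger_mult\<close>.\<close>

lemma poly_mapping_single_add_induct [case_names zero single add]:
  fixes p :: "'a \<Rightarrow>\<^sub>0 'b::comm_monoid_add"
  assumes "P 0" "\<And>k v. P (Poly_Mapping.single k v)" "\<And>p q. P p \<Longrightarrow> P q \<Longrightarrow> P (p + q)"
  shows "P p"
proof -
  have "P (\<Sum>k\<in>K. Poly_Mapping.single k (Poly_Mapping.lookup p k))" for K
    by (induction K rule: infinite_finite_induct) (auto intro: assms)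
  then show ?thesis by (metis poly_mapping_eq_sum_single)
qed

lemma lookup_lscale [simp]: "Poly_Mapping.lookup (lscale c p) k = c * Poly_Mapping.lookup p k"
proof (induction p rule: poly_mapping_single_add_induct)
  case (single k' v)
  then show ?case by (simp add: lscale_def mult_single lookup_single when_def)
qed (simp_all add: laurent.scale_right_distrib lookup_add distrib_left)

lemma keys_lmono [simp]: "Poly_Mapping.keys (lmono i j) = {(i, j)}"
  by (simp add: lmono_def)

lemma single_eq_lscale: "Poly_Mapping.single (i, j) c = lscale c (lmono i j)"
  by (simp add: lscale_def lmono_def mult_single)

lemma lmono_0_0 [simp]: "lmono 0 0 = 1"
  by (simp add: lmono_def flip: zero_prod_def)

lemma lmono_mult: "lmono i j * lmono k l = lmono (i + k) (j + l)"
  by (simp add: lmono_def mult_single)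

lemma subspace_keys: "laurent.subspace {p. Poly_Mapping.keys p \<subseteq> S}"
  unfolding laurent.subspace_def
  by (auto simp: in_keys_iff subset_iff lookup_add; metis add.right_neutral)

text \<open>Turns every later span membership into an inclusion of exponent sets. One direction
  holds because polynomials supported in \<open>S\<close> form a subspace; the other writes
  \<open>p\<close> as the sum of its terms.\<close>

lemma mem_lspan_of: "p \<in> lspan_of S \<longleftrightarrow> Poly_Mapping.keys p \<subseteq> S"
proof
  have "lspan_of S \<subseteq> {p. Poly_Mapping.keys p \<subseteq> S}"
    unfolding lspan_of_def by (rule laurent.span_minimal[OF _ subspace_keys]) auto
  then show "p \<in> lspan_of S \<Longrightarrow> Poly_Mapping.keys p \<subseteq> S" by auto
next
  assume *: "Poly_Mapping.keys p \<subseteq> S"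
  have "(\<Sum>k\<in>Poly_Mapping.keys p. Poly_Mapping.single k (Poly_Mapping.lookup p k)) \<in> lspan_of S"
    unfolding lspan_of_def
  proof (rule laurent.span_sum)
    fix k assume "k \<in> Poly_Mapping.keys p"
    then show "Poly_Mapping.single k (Poly_Mapping.lookup p k) \<in> lspan ((\<lambda>(i, j). lmono i j) ` S)"
      using * by (cases k) (auto simp: single_eq_lscale intro!: laurent.span_scale intro: laurent.span_base)
  qed
  then show "p \<in> lspan_of S" by (metis poly_mapping_eq_sum_single)
qed

lemma subspace_lspan_of: "laurent.subspace (lspan_of S)"
  unfolding lspan_of_def by (rule laurent.subspace_span)

lemma lspan_of_mono: "S \<subseteq> S' \<Longrightarrow> lspan_of S \<subseteq> lspan_of S'"
  by (auto simp: mem_lspan_of)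

lemma inj_lmono: "inj_on (\<lambda>(i, j). lmono i j) S"
  by (auto simp: inj_on_def lmono_def dest: arg_cong[where f = Poly_Mapping.keys])

text \<open>By \<open>mem_lspan_of\<close>, a monomial in the span of the others would have its
  exponent in a set from which that exponent was removed.\<close>

lemma independent_lmono: "laurent.independent ((\<lambda>(i, j). lmono i j) ` S)"
  unfolding laurent.dependent_def
proof safe
  fix i j assume ij: "(i, j) \<in> S" 
    and "lmono i j \<in> lspan ((\<lambda>(i, j). lmono i j) ` S - {lmono i j})"
  moreover have "(\<lambda>(i, j). lmono i j) ` S - {lmono i j} \<subseteq> (\<lambda>(i, j). lmono i j) ` (S - {(i, j)})"
    by auto
  ultimately have "lmono i j \<in> lspan_of (S - {(i, j)})"
    unfolding lspan_of_def using laurent.span_mono by blast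
  then show False by (simp add: mem_lspan_of)
qed

section \<open>The involution \<open>ldagger\<close>\<close>

lemma ldagger_add: "ldagger (p + q) = ldagger p + ldagger q"
  by transfer (simp add: fun_eq_iff)

lemma ldagger_single: "ldagger (Poly_Mapping.single k c) = Poly_Mapping.single (- k) (cnj c)"
  by transfer (auto simp: fun_eq_iff when_def equation_minus_iff)

lemma ldagger_ldagger [simp]: "ldagger (ldagger p) = p"
  by transfer simp

lemma ldagger_lmono [simp]: "ldagger (lmono i j) = lmono (- i) (- j)"
  by (simp add: lmono_def ldagger_single uminus_prod_def)

lemma ldagger_zero [simp]: "ldagger 0 = 0"
  by transfer simp

lemma ldagger_mult: "ldagger (p * q) = ldagger p * ldagger q"
proof (induction p rule: poly_mapping_single_add_induct)
  case (single k v)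
  show ?case
  proof (induction q rule: poly_mapping_single_add_induct)
    case (single k v)
    then show ?case by (simp add: ldagger_single mult_single)
  qed (simp_all add: ldagger_add distrib_left)
qed (simp_all add: ldagger_add distrib_right)

lemma ldagger_lscale: "ldagger (lscale c p) = lscale (cnj c) (ldagger p)"
  by (simp add: lscale_def ldagger_mult ldagger_single)

lemma keys_ldagger: "Poly_Mapping.keys (ldagger p) = uminus ` Poly_Mapping.keys p"
proof -
  have "k \<in> uminus ` Poly_Mapping.keys p" if "- k \<in> Poly_Mapping.keys p" for k
    using that by (metis add.inverse_inverse imageI)
  then show ?thesis by (auto simp: in_keys_iff ldagger.rep_eq)
qed

lemma mult_mem_lspan_of:
  assumes "p \<in> lspan_of S" "q \<in> lspan_of T" "\<And>a b. a \<in> S \<Longrightarrow> b \<in> T \<Longrightarrow> a + b \<in> U"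
  shows "p * q \<in> lspan_of U"
  using assms keys_mult[of p q] unfolding mem_lspan_of by blast

section \<open>The inner product of a positive definite functional\<close>

locale pos_def_laurent =
  fixes L :: "laurent \<Rightarrow> complex" and N M :: int
  assumes pos_def: "pos_def_functional N M L"
begin

definition ip :: "laurent \<Rightarrow> laurent \<Rightarrow> complex" where
  "ip p q = L (p * ldagger q)"

abbreviation box :: "(int \<times> int) set" where "box \<equiv> {0..N} \<times> {0..M}"

text \<open>Differences of exponents in \<open>box\<close> stay in the symmetric rectangle, where
  \<open>L\<close> is linear. This is why the laws of \<open>ip\<close> below carry membership
  hypotheses.\<close>

lemma mult_ldagger_mem:
  assumes "p \<in> lspan_of box" "q \<in> lspan_of box"
  shows "p * ldagger q \<in> Pi_sym N M"
  unfolding Pi_sym_def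
proof (rule mult_mem_lspan_of[OF assms(1)])
  show "ldagger q \<in> lspan_of (uminus ` box)"
    using assms(2) unfolding mem_lspan_of keys_ldagger by blast
qed auto

lemma L_add: "p \<in> Pi_sym N M \<Longrightarrow> q \<in> Pi_sym N M \<Longrightarrow> L (p + q) = L p + L q"
  and L_scale: "p \<in> Pi_sym N M \<Longrightarrow> L (lscale c p) = c * L p"
  and L_lmono: "i \<in> {- N..N} \<Longrightarrow> j \<in> {- M..M} \<Longrightarrow> L (lmono (- i) (- j)) = cnj (L (lmono i j))"
  and L_pos: "p \<in> lspan_of box \<Longrightarrow> p \<noteq> 0 \<Longrightarrow> cpos (L (p * ldagger p))"
  using pos_def unfolding pos_def_functional_def Pi_hat_def by blast+

lemma L_zero: "L 0 = 0"
  using L_scale[of 0 0] by (simp add: Pi_sym_def mem_lspan_of)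

text \<open>Hermitian symmetry is given on monomials only. Both sides are conjugate linear in
  \<open>p\<close>, so the polynomials satisfying it form a subspace, which contains the monomials
  of the rectangle.\<close>

lemma L_ldagger:
  assumes "p \<in> Pi_sym N M"
  shows "L (ldagger p) = cnj (L p)"
proof -
  have mem: "ldagger p \<in> Pi_sym N M" if "p \<in> Pi_sym N M" for p
    using that unfolding Pi_sym_def mem_lspan_of keys_ldagger by force
  have "lspan_of ({- N..N} \<times> {- M..M}) \<subseteq> {p \<in> Pi_sym N M. L (ldagger p) = cnj (L p)}"
    unfolding lspan_of_def
  proof (rule laurent.span_minimal)
    show "laurent.subspace {p \<in> Pi_sym N M. L (ldagger p) = cnj (L p)}"
      using subspace_lspan_of[of "{- N..N} \<times> {- M..M}"]
      unfolding laurent.subspace_def Pi_sym_def[symmetric]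
      by (auto simp: mem L_zero ldagger_add L_add ldagger_lscale L_scale)
  qed (auto simp: L_lmono Pi_sym_def mem_lspan_of)
  then show ?thesis using assms unfolding Pi_sym_def by blast
qed

lemma ip_add_left:
  assumes "p \<in> lspan_of box" "p' \<in> lspan_of box" "q \<in> lspan_of box"
  shows "ip (p + p') q = ip p q + ip p' q"
  using assms by (simp add: ip_def distrib_right L_add mult_ldagger_mem)

lemma ip_scale_left:
  assumes "p \<in> lspan_of box" "q \<in> lspan_of box"
  shows "ip (lscale c p) q = c * ip p q"
  using L_scale[OF mult_ldagger_mem[OF assms], of c] by (simp add: ip_def lscale_def mult.assoc)

lemma ip_commute:
  assumes "p \<in> lspan_of box" "q \<in> lspan_of box"
  shows "ip q p = cnj (ip p q)"
  using L_ldagger[OF mult_ldagger_mem[OF assms]] by (simp add: ip_def ldagger_mult mult.commute)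

lemma ip_zero_left [simp]: "ip 0 q = 0"
  by (simp add: ip_def L_zero)

lemma scale_mem: "p \<in> lspan_of S \<Longrightarrow> lscale c p \<in> lspan_of S"
  and add_mem: "p \<in> lspan_of S \<Longrightarrow> q \<in> lspan_of S \<Longrightarrow> p + q \<in> lspan_of S"
  and diff_mem: "p \<in> lspan_of S \<Longrightarrow> q \<in> lspan_of S \<Longrightarrow> p - q \<in> lspan_of S"
  and sum_mem: "(\<And>i. i \<in> I \<Longrightarrow> f i \<in> lspan_of S) \<Longrightarrow> sum f I \<in> lspan_of S"
  using subspace_lspan_of[of S]
  by (auto intro: laurent.subspace_scale laurent.subspace_add laurent.subspace_diff
      laurent.subspace_sum)

lemma ip_diff_left:
  assumes "p \<in> lspan_of box" "p' \<in> lspan_of box" "q \<in> lspan_of box"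
  shows "ip (p - p') q = ip p q - ip p' q"
  using ip_add_left[of "p - p'" p' q] assms by (simp add: diff_mem)

lemma ip_sum_left:
  assumes "\<And>i. i \<in> I \<Longrightarrow> f i \<in> lspan_of box" "q \<in> lspan_of box"
  shows "ip (sum f I) q = (\<Sum>i\<in>I. ip (f i) q)"
  using assms(1)
proof (induction I rule: infinite_finite_induct)
  case (insert i I)
  then show ?case by (simp add: ip_add_left sum_mem assms(2))
qed auto

lemma ip_eq_zero_imp:
  assumes "p \<in> lspan_of box" "ip p p = 0"
  shows "p = 0"
  using L_pos[OF assms(1)] assms(2) by (auto simp: ip_def cpos_def)

section \<open>Orthogonality to monomials and orthogonal projection\<close>

definition orth :: "laurent \<Rightarrow> (int \<times> int) set \<Rightarrow> bool" where
  "orth p T \<longleftrightarrow> (\<forall>q\<in>lspan_of T. ip p q = 0)"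

lemma orth_mono: "orth p T \<Longrightarrow> T' \<subseteq> T \<Longrightarrow> orth p T'"
  using lspan_of_mono unfolding orth_def by blast

text \<open>Linearity is available in the first argument, so the subspace argument is run on
  \<open>ip q p\<close> and transferred by \<open>ip_commute\<close>. The generating set
  \<open>B\<close> is arbitrary because monomials mixed with orthonormal polynomials are needed
  later.\<close>

lemma ip_span_zero:
  assumes p: "p \<in> lspan_of box" and B: "\<And>b. b \<in> B \<Longrightarrow> b \<in> lspan_of box \<and> ip p b = 0"
    and q: "q \<in> lspan B"
  shows "ip p q = 0"
proof -
  have "lspan B \<subseteq> {q \<in> lspan_of box. ip q p = 0}"
  proof (rule laurent.span_minimal)
    show "B \<subseteq> {q \<in> lspan_of box. ip q p = 0}"
    proof safe
      fix b assume "b \<in> B"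
      then show "b \<in> lspan_of box" "ip b p = 0"
        using B[of b] ip_commute[OF p, of b] by auto
    qed
    show "laurent.subspace {q \<in> lspan_of box. ip q p = 0}"
      using subspace_lspan_of[of box] p unfolding laurent.subspace_def
      by (auto simp: ip_add_left ip_scale_left)
  qed
  then have "q \<in> lspan_of box" "ip q p = 0" using q by auto
  then show ?thesis using ip_commute[of q p] p by simp
qed

lemma orthI:
  assumes "p \<in> lspan_of box" "T \<subseteq> box" "\<And>i j. (i, j) \<in> T \<Longrightarrow> ip p (lmono i j) = 0"
  shows "orth p T"
  unfolding orth_def
proof
  fix q assume "q \<in> lspan_of T"
  then show "ip p q = 0"
    unfolding lspan_of_def
    by (rule ip_span_zero[OF assms(1), rotated]) (use assms in \<open>auto simp: mem_lspan_of\<close>)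
qed

text \<open>Gram-Schmidt by induction on \<open>T\<close>: the new monomial is first made orthogonal
  to the old ones, giving \<open>u\<close>, and then the component of \<open>p - q\<close> along
  \<open>u\<close> is removed as well.\<close>

lemma orthogonal_projection:
  assumes "finite T" "T \<subseteq> box" "p \<in> lspan_of box"
  shows "\<exists>q\<in>lspan_of T. orth (p - q) T"
  using assms
proof (induction T arbitrary: p rule: finite_induct)
  case empty
  then have "orth (p - 0) {}" by (intro orthI) auto
  then show ?case by (rule bexI) (simp add: mem_lspan_of)
next
  case (insert t T)
  obtain i j where t: "t = (i, j)" by fastforce
  have box: "lmono i j \<in> lspan_of box" and T: "T \<subseteq> box"
    using insert.prems t by (auto simp: mem_lspan_of)
  have sub: "lspan_of T \<subseteq> lspan_of box" "lspan_of T \<subseteq> lspan_of (insert t T)"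
    by (intro lspan_of_mono T subset_insertI)+
  obtain r where r: "r \<in> lspan_of T" "orth (lmono i j - r) T"
    using insert.IH[OF T box] by blast
  obtain q where q: "q \<in> lspan_of T" "orth (p - q) T"
    using insert.IH[OF T] insert.prems by blast
  define u where "u = lmono i j - r"
  define c where "c = ip (p - q) u / ip u u"
  have mems: "u \<in> lspan_of box" "q \<in> lspan_of box" "r \<in> lspan_of box"
    using q r sub box by (auto simp: u_def diff_mem)
  \<comment> \<open>If \<open>ip u u = 0\<close>, the quotient defining \<open>c\<close> is 0 by
    convention; then \<open>u = 0\<close> by definiteness and both sides vanish.\<close>
  have c: "ip (p - q) u = c * ip u u"
    using ip_eq_zero_imp[OF mems(1)] ip_commute[of u "p - q"] mems insert.prems
    by (cases "ip u u = 0") (auto simp: c_def diff_mem)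
  show ?case
  proof (intro bexI[of _ "q + lscale c u"] orthI)
    have "lmono i j \<in> lspan_of (insert t T)" using t by (simp add: mem_lspan_of)
    then show "q + lscale c u \<in> lspan_of (insert t T)"
      unfolding u_def using q(1) r(1) sub(2) by (intro add_mem scale_mem diff_mem) blast+
    show "p - (q + lscale c u) \<in> lspan_of box"
      using mems insert.prems by (intro add_mem scale_mem diff_mem)
    show "insert t T \<subseteq> box" by fact
    have orth: "ip (p - (q + lscale c u)) v = 0" if "v \<in> lspan_of T" for v
    proof -
      have "v \<in> lspan_of box" using that sub by blast
      then have "ip (p - q - lscale c u) v = ip (p - q) v - c * ip u v"
        using mems insert.prems by (simp add: ip_diff_left ip_scale_left scale_mem diff_mem)
      then show ?thesis using that q(2) r(2) by (simp add: orth_def u_def diff_diff_eq)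
    qed
    fix i' j' assume "(i', j') \<in> insert t T"
    then consider "(i', j') \<in> T" | "i' = i" "j' = j" using t by auto
    then show "ip (p - (q + lscale c u)) (lmono i' j') = 0"
    proof cases
      case 1
      then show ?thesis by (intro orth) (simp add: mem_lspan_of)
    next
      case 2
      \<comment> \<open>The new monomial is \<open>u + r\<close>. The error is orthogonal to
        \<open>u\<close> by the choice of \<open>c\<close>, and to \<open>r\<close> because
        \<open>r\<close> has exponents in \<open>T\<close>.\<close>
      let ?e = "p - (q + lscale c u)"
      have e: "?e \<in> lspan_of box" using mems insert.prems by (intro add_mem scale_mem diff_mem)
      have "ip ?e u = ip (p - q) u - c * ip u u"
        using mems insert.prems by (simp add: diff_diff_eq[symmetric] ip_diff_left ip_scale_left scale_mem diff_mem)
      then have "ip u ?e = 0" using c ip_commute[OF e mems(1)] by simp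
      moreover have "ip r ?e = 0" using orth[OF r(1)] ip_commute[OF e mems(3)] by simp
      ultimately have "ip (lmono i j) ?e = 0"
        using ip_add_left[OF mems(1,3) e] by (simp add: u_def)
      then show ?thesis using 2 ip_commute[OF box e] by simp
    qed
  qed
qed

lemma ip_scale_right:
  assumes "p \<in> lspan_of box" "q \<in> lspan_of box"
  shows "ip p (lscale c q) = cnj c * ip p q"
proof -
  have "ip p (lscale c q) = cnj (c * ip q p)"
    using ip_commute[OF scale_mem[OF assms(2)] assms(1), of c] ip_scale_left[OF assms(2,1)] by simp
  then show ?thesis using ip_commute[OF assms(2,1)] by simp
qed

section \<open>Existence and uniqueness of the orthonormal polynomials\<close>

lemma is_orthonormal_poly_iff:
  assumes "S \<subseteq> box"
  shows "is_orthonormal_poly L S k p \<longleftrightarrow>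
    p \<in> lspan_of S \<and> cpos (Poly_Mapping.lookup p k) \<and> ip p p = 1 \<and> orth p (S - {k})"
proof -
  have "orth p (S - {k}) \<longleftrightarrow> (\<forall>(i, j)\<in>S - {k}. ip p (lmono i j) = 0)" if "p \<in> lspan_of S"
  proof
    assume "orth p (S - {k})"
    then show "\<forall>(i, j)\<in>S - {k}. ip p (lmono i j) = 0"
      by (auto simp: orth_def mem_lspan_of)
  next
    assume "\<forall>(i, j)\<in>S - {k}. ip p (lmono i j) = 0"
    then show "orth p (S - {k})"
      using lspan_of_mono[OF assms] that assms by (intro orthI) auto
  qed
  then show ?thesis unfolding is_orthonormal_poly_def ip_def by blast
qed

lemma mem_lspan_of_remove:
  "p \<in> lspan_of S \<Longrightarrow> Poly_Mapping.lookup p k = 0 \<Longrightarrow> p \<in> lspan_of (S - {k})"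
  by (auto simp: mem_lspan_of in_keys_iff)

text \<open>Cross-multiplying by the leading coefficients cancels the term at \<open>k\<close>, so
  the difference \<open>d\<close> lies in the span to which \<open>p\<close> and \<open>q\<close>
  are both orthogonal. Hence \<open>d\<close> is orthogonal to itself and vanishes. Equal norms and
  positivity then force the two leading coefficients to agree.\<close>

lemma orthonormal_poly_unique:
  assumes S: "S \<subseteq> box"
    and p: "is_orthonormal_poly L S k p" and q: "is_orthonormal_poly L S k q"
  shows "p = q"
proof -
  note sub = lspan_of_mono[OF S, THEN subsetD]
  have p': "p \<in> lspan_of S" "ip p p = 1" "orth p (S - {k})"
    and q': "q \<in> lspan_of S" "ip q q = 1" "orth q (S - {k})"
    using p q by (simp_all add: is_orthonormal_poly_iff[OF S])
  obtain a b :: real where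
    a: "Poly_Mapping.lookup p k = of_real a" "a > 0" and b: "Poly_Mapping.lookup q k = of_real b" "b > 0"
    using p q unfolding is_orthonormal_poly_iff[OF S] cpos_def by (auto elim!: Reals_cases)
  define d where "d = lscale (of_real b) p - lscale (of_real a) q"
  have "d \<in> lspan_of S" unfolding d_def by (intro diff_mem scale_mem p' q')
  then have d: "d \<in> lspan_of (S - {k})"
    by (rule mem_lspan_of_remove) (simp add: d_def a b lookup_minus)
  then have "ip p d = 0" "ip q d = 0" using p'(3) q'(3) by (auto simp: orth_def)
  then have "ip d d = 0"
    using sub[OF p'(1)] sub[OF q'(1)] sub[OF \<open>d \<in> lspan_of S\<close>]
    by (subst (1) d_def) (simp add: ip_diff_left ip_scale_left scale_mem)
  then have "d = 0" using ip_eq_zero_imp sub[OF \<open>d \<in> lspan_of S\<close>] by blast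
  then have eq: "lscale (of_real b) p = lscale (of_real a) q" by (simp add: d_def)
  have "ip (lscale (of_real b) p) (lscale (of_real b) p) = of_real (b * b)"
    using sub[OF p'(1)] by (simp add: ip_scale_left ip_scale_right scale_mem p'(2))
  moreover have "ip (lscale (of_real a) q) (lscale (of_real a) q) = of_real (a * a)"
    using sub[OF q'(1)] by (simp add: ip_scale_left ip_scale_right scale_mem q'(2))
  ultimately have "b * b = a * a" using eq by (metis of_real_eq_iff)
  then have "b = a" using a(2) b(2) by (metis abs_of_pos real_sqrt_abs2)
  then show ?thesis using eq a(2) by simp
qed

text \<open>Subtract from the monomial at \<open>k\<close> its projection onto the other monomials
  and normalise. The coefficient at \<open>k\<close> stays 1, so the difference is nonzero and has
  positive norm.\<close>

lemma orthonormal_poly_exists: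
  assumes S: "S \<subseteq> box" and k: "k \<in> S"
  shows "\<exists>p. is_orthonormal_poly L S k p"
proof -
  note sub = lspan_of_mono[OF S, THEN subsetD]
  obtain i j where ij: "k = (i, j)" by fastforce
  have mono: "lmono i j \<in> lspan_of S" using k ij by (simp add: mem_lspan_of)
  have "finite (S - {k})" using S finite_subset by blast
  then obtain q where q: "q \<in> lspan_of (S - {k})" "orth (lmono i j - q) (S - {k})"
    using orthogonal_projection[OF _ _ sub[OF mono], of "S - {k}"] S by auto
  define u where "u = lmono i j - q"
  have "q \<in> lspan_of S" using q(1) by (auto simp: mem_lspan_of)
  then have u: "u \<in> lspan_of S" unfolding u_def using mono by (intro diff_mem)
  have lookup: "Poly_Mapping.lookup u k = 1"
    using q(1) by (auto simp: u_def ij lookup_minus lmono_def mem_lspan_of in_keys_iff subset_iff)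
  then have "u \<noteq> 0" by auto
  then have "cpos (ip u u)" unfolding ip_def by (rule L_pos[OF sub[OF u]])
  then obtain r where r: "ip u u = of_real r" "r > 0"
    unfolding cpos_def by (auto elim!: Reals_cases)
  let ?c = "complex_of_real (1 / sqrt r)"
  have "is_orthonormal_poly L S k (lscale ?c u)"
    unfolding is_orthonormal_poly_iff[OF S]
  proof (intro conjI)
    show "lscale ?c u \<in> lspan_of S" by (intro scale_mem u)
    have "cpos ?c" using r(2) unfolding cpos_def by simp
    then show "cpos (Poly_Mapping.lookup (lscale ?c u) k)"
      unfolding lookup_lscale lookup mult_1_right .
    have "ip (lscale ?c u) (lscale ?c u) = of_real (1 / sqrt r * (1 / sqrt r) * r)"
      unfolding ip_scale_left[OF sub[OF u] scale_mem[OF sub[OF u]]]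
        ip_scale_right[OF sub[OF u] sub[OF u]] r(1)
      by (simp only: complex_cnj_complex_of_real of_real_mult mult.assoc)
    also have "1 / sqrt r * (1 / sqrt r) * r = 1" using r(2) by simp
    finally show "ip (lscale ?c u) (lscale ?c u) = 1" by simp
    have "ip (lscale ?c u) v = 0" if "v \<in> lspan_of (S - {k})" for v
    proof -
      have "v \<in> lspan_of box" using that S by (auto simp: mem_lspan_of)
      then have "ip (lscale ?c u) v = ?c * ip u v" by (rule ip_scale_left[OF sub[OF u]])
      also have "ip u v = 0" using q(2) that unfolding orth_def u_def by blast
      finally show ?thesis by simp
    qed
    then show "orth (lscale ?c u) (S - {k})" unfolding orth_def by blast
  qed
  then show ?thesis by blast
qed

lemma is_orthonormal_poly_The:
  assumes "S \<subseteq> box" "k \<in> S"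
  shows "is_orthonormal_poly L S k (THE p. is_orthonormal_poly L S k p)"
proof (rule theI', rule ex_ex1I)
  show "\<exists>p. is_orthonormal_poly L S k p" by (rule orthonormal_poly_exists[OF assms])
qed (rule orthonormal_poly_unique[OF assms(1)])

section \<open>Orthonormal families and the Parseval identity\<close>

text \<open>The index type is left free so that two families can be joined over a disjoint
  sum.\<close>

definition orthonormal_family ::
    "'i set \<Rightarrow> ('i \<Rightarrow> laurent) \<Rightarrow> (int \<times> int) set \<Rightarrow> (int \<times> int) set \<Rightarrow> bool" where
  "orthonormal_family J f S T \<longleftrightarrow>
     (\<forall>r\<in>J. f r \<in> lspan_of S \<and> orth (f r) T) \<and>
     (\<forall>r\<in>J. \<forall>s\<in>J. ip (f r) (f s) = (if r = s then 1 else 0))"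

lemma orthonormal_family_mono:
  assumes "orthonormal_family J f S T" "S \<subseteq> S'" "T' \<subseteq> T"
  shows "orthonormal_family J f S' T'"
  unfolding orthonormal_family_def
proof (intro conjI ballI)
  fix r assume "r \<in> J"
  then have "f r \<in> lspan_of S" "orth (f r) T"
    using assms(1) unfolding orthonormal_family_def by auto
  then show "f r \<in> lspan_of S'" "orth (f r) T'"
    using lspan_of_mono[OF assms(2)] orth_mono[OF _ assms(3)] by auto
next
  fix r s assume "r \<in> J" "s \<in> J"
  then show "ip (f r) (f s) = (if r = s then 1 else 0)"
    using assms(1) unfolding orthonormal_family_def by blast
qed

lemma orthonormal_family_mem:
  assumes "orthonormal_family J f S T" "S \<subseteq> box" "r \<in> J"
  shows "f r \<in> lspan_of box"
  using assms lspan_of_mono[OF assms(2)] unfolding orthonormal_family_def by blast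

text \<open>The inclusion \<open>S' \<subseteq> T\<close> makes the families mutually orthogonal:
  each \<open>f i\<close> is orthogonal to all polynomials with exponents in \<open>T\<close>, and
  the \<open>g j\<close> are among these.\<close>

lemma orthonormal_family_Plus:
  assumes f: "orthonormal_family I f S T" and g: "orthonormal_family J g S' T'"
    and "S \<subseteq> box" "S' \<subseteq> box" "S' \<subseteq> T"
  shows "orthonormal_family (I <+> J) (case_sum f g) (S \<union> S') (T \<inter> T')"
proof -
  have fg: "ip (f i) (g j) = 0 \<and> ip (g j) (f i) = 0" if "i \<in> I" "j \<in> J" for i j
  proof -
    have "ip (f i) (g j) = 0"
      using f g that lspan_of_mono[OF \<open>S' \<subseteq> T\<close>] unfolding orthonormal_family_def orth_def by blast
    moreover have "f i \<in> lspan_of box" "g j \<in> lspan_of box"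
      using f g that lspan_of_mono[of S box] lspan_of_mono[of S' box] assms(3,4)
      unfolding orthonormal_family_def by blast+
    ultimately show ?thesis using ip_commute[of "f i" "g j"] by simp
  qed
  have "f i \<in> lspan_of (S \<union> S') \<and> orth (f i) (T \<inter> T')" if "i \<in> I" for i
    using f that lspan_of_mono[of S "S \<union> S'"] orth_mono[of "f i" T "T \<inter> T'"]
    unfolding orthonormal_family_def by blast
  moreover have "g j \<in> lspan_of (S \<union> S') \<and> orth (g j) (T \<inter> T')" if "j \<in> J" for j
    using g that lspan_of_mono[of S' "S \<union> S'"] orth_mono[of "g j" T' "T \<inter> T'"]
    unfolding orthonormal_family_def by blast
  moreover have "ip (f i) (f i') = (if i = i' then 1 else 0)" if "i \<in> I" "i' \<in> I" for i i'
    using f that unfolding orthonormal_family_def by blast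
  moreover have "ip (g j) (g j') = (if j = j' then 1 else 0)" if "j \<in> J" "j' \<in> J" for j j'
    using g that unfolding orthonormal_family_def by blast
  ultimately show ?thesis
    using fg unfolding orthonormal_family_def by (auto elim!: PlusE split: if_splits)
qed

text \<open>A new member lying in the span of the monomials of \<open>T\<close> and the earlier
  members would be orthogonal to itself, against norm one. The cardinality is tracked because it
  drives the dimension count in \<open>orthonormal_expansion\<close>.\<close>

lemma independent_lmono_orthonormal:
  assumes "finite J" "orthonormal_family J e S T" "S \<subseteq> box" "T \<subseteq> box"
  shows "laurent.independent ((\<lambda>(i, j). lmono i j) ` T \<union> e ` J) \<and>
    card ((\<lambda>(i, j). lmono i j) ` T \<union> e ` J) = card T + card J"
  using assms(1,2)
proof (induction J rule: finite_induct)
  case empty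
  then show ?case by (simp add: independent_lmono card_image[OF inj_lmono])
next
  case (insert j J)
  let ?B = "(\<lambda>(i, j). lmono i j) ` T \<union> e ` J"
  have J: "orthonormal_family J e S T"
    using insert.prems unfolding orthonormal_family_def by blast
  have e: "e k \<in> lspan_of box" if "k \<in> insert j J" for k
    using insert.prems that lspan_of_mono[OF assms(3)] unfolding orthonormal_family_def by blast
  have "e j \<notin> lspan ?B"
  proof
    assume "e j \<in> lspan ?B"
    then have "ip (e j) (e j) = 0"
    proof (rule ip_span_zero[rotated 2])
      fix b assume "b \<in> ?B"
      then consider i l where "(i, l) \<in> T" "b = lmono i l" | k where "k \<in> J" "b = e k" by auto
      then show "b \<in> lspan_of box \<and> ip (e j) b = 0"
      proof cases
        case 1
        then have "b \<in> lspan_of T" by (simp add: mem_lspan_of)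
        then show ?thesis
          using insert.prems lspan_of_mono[OF assms(4)] unfolding orthonormal_family_def orth_def by blast
      next
        case 2
        then show ?thesis
          using insert.prems insert.hyps e unfolding orthonormal_family_def by auto
      qed
    qed (simp add: e)
    then show False using insert.prems unfolding orthonormal_family_def by simp
  qed
  then have "e j \<notin> ?B" by (rule contrapos_nn) (rule laurent.span_base)
  moreover have "finite T" using assms(4) by (rule finite_subset) simp
  then have "finite ?B" using insert.hyps by simp
  ultimately show ?case
    using insert.IH[OF J] insert.hyps laurent.independent_insertI[OF \<open>e j \<notin> lspan ?B\<close>]
    by simp
qed

text \<open>By the cardinality hypothesis, the monomials with exponents in \<open>T\<close> together with the
  family \<open>e\<close> form a basis of \<open>lspan_of S\<close>.\<close>

lemma orthonormal_expansion:
  assumes J: "finite J" and e: "orthonormal_family J e S T" and TS: "T \<subseteq> S" and S: "S \<subseteq> box"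
    and card: "card S = card T + card J" and x: "x \<in> lspan_of S" "orth x T"
  shows "x = (\<Sum>j\<in>J. lscale (ip x (e j)) (e j))"
proof -
  let ?B = "(\<lambda>(i, j). lmono i j) ` T \<union> e ` J"
  note sub = lspan_of_mono[OF S, THEN subsetD]
  have T: "T \<subseteq> box" using TS S by blast
  have finS: "finite S" using S finite_subset by blast
  have ind: "laurent.independent ?B" and cardB: "card ?B = card S"
    using independent_lmono_orthonormal[OF J e S T] card by auto
  have eS: "e j \<in> lspan_of S" if "j \<in> J" for j
    using e that unfolding orthonormal_family_def by blast
  note box = sub[OF x(1)] sub[OF eS]
  have BS: "?B \<subseteq> lspan_of S" using eS TS by (auto simp: mem_lspan_of)
  \<comment> \<open>Dimension count: otherwise \<open>insert v ?B\<close> would be an independent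
    set of \<open>card S + 1\<close> elements in the span of \<open>card S\<close>
    monomials.\<close>
  have span: "v \<in> lspan ?B" if v: "v \<in> lspan_of S" for v
  proof (rule ccontr)
    assume "v \<notin> lspan ?B"
    then have ind': "laurent.independent (insert v ?B)" and "v \<notin> ?B"
      using ind laurent.independent_insertI laurent.span_base[of v ?B] by metis+
    have "insert v ?B \<subseteq> lspan ((\<lambda>(i, j). lmono i j) ` S)"
      using BS v unfolding lspan_of_def by blast
    then have "card (insert v ?B) \<le> card ((\<lambda>(i, j). lmono i j) ` S)"
      using laurent.independent_span_bound[OF finite_imageI[OF finS] ind'] by simp
    moreover have "finite ?B" using J finite_subset[OF TS finS] by simp
    ultimately show False
      using \<open>v \<notin> ?B\<close> cardB by (simp add: card_image[OF inj_lmono])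
  qed
  define d where "d = x - (\<Sum>j\<in>J. lscale (ip x (e j)) (e j))"
  have dS: "d \<in> lspan_of S"
    unfolding d_def by (intro diff_mem x sum_mem scale_mem eS)
  have ip_d: "ip d v = ip x v - (\<Sum>j\<in>J. ip x (e j) * ip (e j) v)" if "v \<in> lspan_of box" for v
  proof -
    have "ip d v = ip x v - ip (\<Sum>j\<in>J. lscale (ip x (e j)) (e j)) v"
      unfolding d_def using that by (intro ip_diff_left box sum_mem scale_mem)
    also have "ip (\<Sum>j\<in>J. lscale (ip x (e j)) (e j)) v = (\<Sum>j\<in>J. ip (lscale (ip x (e j)) (e j)) v)"
      using that by (intro ip_sum_left box scale_mem)
    also have "\<dots> = (\<Sum>j\<in>J. ip x (e j) * ip (e j) v)"
      using that by (intro sum.cong refl ip_scale_left box)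
    finally show ?thesis .
  qed
  \<comment> \<open>The remainder \<open>d\<close> is orthogonal to every element of the basis
    \<open>?B\<close> and lies in its span.\<close>
  have "ip d d = 0"
  proof (rule ip_span_zero[OF sub[OF dS] _ span[OF dS]])
    fix b assume b: "b \<in> ?B"
    then have bbox: "b \<in> lspan_of box" using BS sub by blast
    from b consider i l where "(i, l) \<in> T" "b = lmono i l" | k where "k \<in> J" "b = e k" by auto
    then have "ip d b = 0"
    proof cases
      case 1
      then have "b \<in> lspan_of T" by (simp add: mem_lspan_of)
      then have "ip x b = 0" "\<And>j. j \<in> J \<Longrightarrow> ip (e j) b = 0"
        using x(2) e unfolding orthonormal_family_def orth_def by blast+
      then show ?thesis by (simp add: ip_d[OF bbox])
    next
      case 2
      have "(\<Sum>j\<in>J. ip x (e j) * ip (e j) b) = (\<Sum>j\<in>J. if j = k then ip x (e j) else 0)"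
        using e 2 unfolding orthonormal_family_def by (intro sum.cong) auto
      also have "\<dots> = ip x b" using 2 J by simp
      finally show ?thesis by (simp add: ip_d[OF bbox])
    qed
    then show "b \<in> lspan_of box \<and> ip d b = 0" using bbox by simp
  qed
  then have "d = 0" by (rule ip_eq_zero_imp[OF sub[OF dS]])
  then show ?thesis by (simp add: d_def)
qed

lemma parseval:
  assumes J: "finite J" and e: "orthonormal_family J e S T" and TS: "T \<subseteq> S" and S: "S \<subseteq> box"
    and card: "card S = card T + card J" and x: "x \<in> lspan_of S" "orth x T"
    and y: "y \<in> lspan_of S"
  shows "ip x y = (\<Sum>j\<in>J. ip x (e j) * cnj (ip y (e j)))"
proof -
  note sub = lspan_of_mono[OF S, THEN subsetD]
  have eS: "e j \<in> lspan_of S" if "j \<in> J" for j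
    using e that unfolding orthonormal_family_def by blast
  note box = sub[OF y] sub[OF eS]
  have "ip x y = ip (\<Sum>j\<in>J. lscale (ip x (e j)) (e j)) y"
    by (rule arg_cong[where f = "\<lambda>u. ip u y"]) (rule orthonormal_expansion[OF J e TS S card x])
  also have "\<dots> = (\<Sum>j\<in>J. ip (lscale (ip x (e j)) (e j)) y)"
    by (intro ip_sum_left scale_mem box)
  also have "\<dots> = (\<Sum>j\<in>J. ip x (e j) * ip (e j) y)"
    by (intro sum.cong refl ip_scale_left box)
  also have "\<dots> = (\<Sum>j\<in>J. ip x (e j) * cnj (ip y (e j)))"
  proof (rule sum.cong[OF refl])
    fix j assume "j \<in> J"
    show "ip x (e j) * ip (e j) y = ip x (e j) * cnj (ip y (e j))"
      by (subst ip_commute[OF box(1) box(2)[OF \<open>j \<in> J\<close>]]) (rule refl)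
  qed
  finally show ?thesis .
qed

section \<open>Shifts and reversals\<close>

text \<open>A monomial times its dagger is 1, so multiplication by it preserves inner products;
  orthogonality to an exponent in \<open>T'\<close> becomes orthogonality to that exponent shifted
  back.\<close>

lemma orthonormal_family_shift:
  assumes f: "orthonormal_family J f S T" and "S' \<subseteq> box" "T' \<subseteq> box"
    and S': "\<And>i j. (i, j) \<in> S \<Longrightarrow> (i + a, j + b) \<in> S'"
    and T': "\<And>i j. (i, j) \<in> T' \<Longrightarrow> (i - a, j - b) \<in> T"
  shows "orthonormal_family J (\<lambda>r. lmono a b * f r) S' T'"
  unfolding orthonormal_family_def
proof (intro conjI ballI)
  fix r assume r: "r \<in> J"
  have "lmono a b \<in> lspan_of {(a, b)}" by (simp add: mem_lspan_of)
  moreover have fr: "f r \<in> lspan_of S" "orth (f r) T"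
    using f r unfolding orthonormal_family_def by auto
  ultimately show mem: "lmono a b * f r \<in> lspan_of S'"
    by (elim mult_mem_lspan_of) (use S' in \<open>auto simp: add.commute\<close>)
  show "orth (lmono a b * f r) T'"
  proof (rule orthI)
    show "lmono a b * f r \<in> lspan_of box" using lspan_of_mono[OF assms(2)] mem by blast
    show "T' \<subseteq> box" by fact
    fix i j assume "(i, j) \<in> T'"
    then have "lmono (i - a) (j - b) \<in> lspan_of T" using T' by (simp add: mem_lspan_of)
    then have "ip (f r) (lmono (i - a) (j - b)) = 0" using fr(2) unfolding orth_def by blast
    moreover have "lmono a b * f r * lmono (- i) (- j) = f r * lmono (- (i - a)) (- (j - b))"
      by (simp add: mult.commute[of _ "f r"] mult.assoc lmono_mult)
    ultimately show "ip (lmono a b * f r) (lmono i j) = 0" by (simp add: ip_def)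
  qed
next
  fix r s assume rs: "r \<in> J" "s \<in> J"
  have "lmono a b * f r * (lmono (- a) (- b) * ldagger (f s))
      = lmono a b * lmono (- a) (- b) * (f r * ldagger (f s))"
    by (simp only: mult_ac)
  also have "\<dots> = f r * ldagger (f s)"
    by (simp add: lmono_mult)
  finally show "ip (lmono a b * f r) (lmono a b * f s) = (if r = s then 1 else 0)"
    using f rs unfolding orthonormal_family_def by (simp add: ip_def ldagger_mult)
qed

text \<open>Reversal is antiunitary: it swaps the two arguments of \<open>ip\<close>, so
  orthonormality survives, and it reflects the exponents in both \<open>S\<close> and
  \<open>T\<close>.\<close>

lemma orthonormal_family_reverse:
  assumes f: "orthonormal_family J f S T" and "S \<subseteq> box" "T \<subseteq> box" "S' \<subseteq> box" "T' \<subseteq> box"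
    and S': "\<And>i j. (i, j) \<in> S \<Longrightarrow> (a - i, b - j) \<in> S'"
    and T': "\<And>i j. (i, j) \<in> T' \<Longrightarrow> (a - i, b - j) \<in> T"
  shows "orthonormal_family J (\<lambda>r. lmono a b * ldagger (f r)) S' T'"
  unfolding orthonormal_family_def
proof (intro conjI ballI)
  fix r assume r: "r \<in> J"
  have fr: "f r \<in> lspan_of S" "orth (f r) T"
    using f r unfolding orthonormal_family_def by auto
  have "lmono a b \<in> lspan_of {(a, b)}" by (simp add: mem_lspan_of)
  moreover have "ldagger (f r) \<in> lspan_of (uminus ` S)"
    using fr(1) unfolding mem_lspan_of keys_ldagger by blast
  ultimately show mem: "lmono a b * ldagger (f r) \<in> lspan_of S'"
    by (elim mult_mem_lspan_of) (use S' in auto)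
  show "orth (lmono a b * ldagger (f r)) T'"
  proof (rule orthI)
    show "lmono a b * ldagger (f r) \<in> lspan_of box" using lspan_of_mono[OF assms(4)] mem by blast
    show "T' \<subseteq> box" by fact
    fix i j assume "(i, j) \<in> T'"
    then have T: "lmono (a - i) (b - j) \<in> lspan_of T" using T' by (simp add: mem_lspan_of)
    then have "ip (f r) (lmono (a - i) (b - j)) = 0" using fr(2) unfolding orth_def by blast
    moreover have "f r \<in> lspan_of box" "lmono (a - i) (b - j) \<in> lspan_of box"
      using fr(1) T lspan_of_mono[OF assms(2)] lspan_of_mono[OF assms(3)] by blast+
    ultimately have "ip (lmono (a - i) (b - j)) (f r) = 0" using ip_commute[of "f r"] by simp
    moreover have "lmono a b * ldagger (f r) * lmono (- i) (- j) = lmono (a - i) (b - j) * ldagger (f r)"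
      by (simp add: mult.commute[of _ "ldagger (f r)"] mult.assoc lmono_mult)
    ultimately show "ip (lmono a b * ldagger (f r)) (lmono i j) = 0" by (simp add: ip_def)
  qed
next
  fix r s assume rs: "r \<in> J" "s \<in> J"
  have "lmono a b * ldagger (f r) * (lmono (- a) (- b) * f s)
      = lmono a b * lmono (- a) (- b) * (f s * ldagger (f r))"
    by (simp only: mult_ac)
  also have "\<dots> = f s * ldagger (f r)"
    by (simp add: lmono_mult)
  finally have "ip (lmono a b * ldagger (f r)) (lmono a b * ldagger (f s)) = ip (f s) (f r)"
    by (simp add: ip_def ldagger_mult)
  then show "ip (lmono a b * ldagger (f r)) (lmono a b * ldagger (f s)) = (if r = s then 1 else 0)"
    using f rs unfolding orthonormal_family_def by auto
qed

section \<open>The families of the vectors \<open>Phi\<close> and \<open>tPhi\<close>\<close>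

definition phi_row :: "int \<Rightarrow> int \<Rightarrow> nat \<Rightarrow> laurent" where
  "phi_row n m r = phi L n m (m - int r)"

definition tphi_row :: "int \<Rightarrow> int \<Rightarrow> nat \<Rightarrow> laurent" where
  "tphi_row n m r = tphi L n m (n - int r)"

text \<open>Here \<open>U l\<close> is an initial segment of the monomial order and
  \<open>k l\<close> its last exponent. Along the chain, the polynomial of smaller index lies in the
  span to which the one of larger index is orthogonal.\<close>

lemma orthonormal_familyI:
  fixes l :: "'i \<Rightarrow> int"
  assumes f: "\<And>r. r \<in> J \<Longrightarrow> is_orthonormal_poly L (U (l r)) (k (l r)) (f r)"
    and U: "\<And>r. r \<in> J \<Longrightarrow> U (l r) \<subseteq> S" and S: "S \<subseteq> box"
    and T: "\<And>r. r \<in> J \<Longrightarrow> T \<subseteq> U (l r) - {k (l r)}"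
    and inj: "inj_on l J"
    and chain: "\<And>r s. r \<in> J \<Longrightarrow> s \<in> J \<Longrightarrow> l r < l s \<Longrightarrow> U (l r) \<subseteq> U (l s) - {k (l s)}"
  shows "orthonormal_family J f S T"
proof -
  have fr: "f r \<in> lspan_of (U (l r))" "ip (f r) (f r) = 1" "orth (f r) (U (l r) - {k (l r)})"
    if "r \<in> J" for r
    using f[OF that] U[OF that] S by (simp_all add: is_orthonormal_poly_iff)
  have mem: "f r \<in> lspan_of S" if "r \<in> J" for r
    using fr(1)[OF that] lspan_of_mono[OF U[OF that]] by blast
  have box: "f r \<in> lspan_of box" if "r \<in> J" for r
    using mem[OF that] lspan_of_mono[OF S] by blast
  have less: "ip (f s) (f r) = 0" if "r \<in> J" "s \<in> J" "l r < l s" for r s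
    using fr(3)[OF that(2)] fr(1)[OF that(1)] lspan_of_mono[OF chain[OF that]]
    unfolding orth_def by blast
  have "ip (f r) (f s) = 0" if rs: "r \<in> J" "s \<in> J" "r \<noteq> s" for r s
  proof -
    have "l r \<noteq> l s" using rs inj by (auto dest: inj_onD)
    then consider "l r < l s" | "l s < l r" by linarith
    then show ?thesis
    proof cases
      case 1
      then have "ip (f s) (f r) = 0" using less rs by blast
      then show ?thesis using ip_commute[OF box[OF rs(2)] box[OF rs(1)]] by simp
    qed (use less rs in blast)
  qed
  then show ?thesis
    using mem fr(2) orth_mono[OF fr(3) T] unfolding orthonormal_family_def by auto
qed

text \<open>There is no lower bound on \<open>m\<close>, so that \<open>m = - 1\<close> yields the
  empty family, as \<open>phi_family_pred\<close> requires when its \<open>m\<close> is 0.\<close>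

lemma orthonormal_family_phi_row:
  assumes "0 \<le> n" "n \<le> N" "m \<le> M"
  shows "orthonormal_family {..<nat (m + 1)} (phi_row n m) ({0..n} \<times> {0..m}) ({0..<n} \<times> {0..m})"
proof (rule orthonormal_familyI[where l = "\<lambda>r. m - int r" and k = "\<lambda>l. (n, l)"
      and U = "\<lambda>l. {0..<n} \<times> {0..m} \<union> {n} \<times> {0..l}"])
  fix r assume "r \<in> {..<nat (m + 1)}"
  then show "is_orthonormal_poly L ({0..<n} \<times> {0..m} \<union> {n} \<times> {0..m - int r}) (n, m - int r)
      (phi_row n m r)"
    unfolding phi_row_def phi_def using assms by (intro is_orthonormal_poly_The) auto
qed (use assms in \<open>auto simp: inj_on_def\<close>)

lemma orthonormal_family_tphi_row:
  assumes "0 \<le> m" "m \<le> M" "n \<le> N"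
  shows "orthonormal_family {..<nat (n + 1)} (tphi_row n m) ({0..n} \<times> {0..m}) ({0..n} \<times> {0..<m})"
proof (rule orthonormal_familyI[where l = "\<lambda>r. n - int r" and k = "\<lambda>l. (l, m)"
      and U = "\<lambda>l. {0..n} \<times> {0..<m} \<union> {0..l} \<times> {m}"])
  fix r assume "r \<in> {..<nat (n + 1)}"
  then show "is_orthonormal_poly L ({0..n} \<times> {0..<m} \<union> {0..n - int r} \<times> {m}) (n - int r, m)
      (tphi_row n m r)"
    unfolding tphi_row_def tphi_def using assms by (intro is_orthonormal_poly_The) auto
qed (use assms in \<open>auto simp: inj_on_def\<close>)

section \<open>Gram matrices\<close>

definition gram :: "nat \<Rightarrow> nat \<Rightarrow> (nat \<Rightarrow> laurent) \<Rightarrow> (nat \<Rightarrow> laurent) \<Rightarrow> complex mat" where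
  "gram a b f g = mat a b (\<lambda>(r, s). ip (f r) (g s))"

lemma gram_carrier [simp]: "gram a b f g \<in> carrier_mat a b"
  by (simp add: gram_def)

text \<open>Replaces matrices over Laurent polynomials by functions on row indices; a column times a
  row has one-term sums as entries.\<close>

lemma linner_eq_gram:
  "linner L (mat a 1 (\<lambda>(r, _). f r)) (mat b 1 (\<lambda>(r, _). g r)) = gram a b f g"
  by (rule eq_matI) (auto simp: linner_def lmat_dagger_def gram_def ip_def scalar_prod_def)

lemma Phi_eq: "Phi L n m = mat (nat (m + 1)) 1 (\<lambda>(r, _). phi_row n m r)"
  by (simp add: Phi_def phi_row_def)

lemma tPhi_eq: "tPhi L n m = mat (nat (n + 1)) 1 (\<lambda>(r, _). tphi_row n m r)"
  by (simp add: tPhi_def tphi_row_def)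

lemma smult_column:
  "c \<cdot>\<^sub>m mat k 1 (\<lambda>(r, _). f r) = mat k 1 (\<lambda>(r, _). c * f r)"
  for c :: "'a::times"
  by (rule eq_matI) auto

lemma transpose_Phi_rev_eq: "transpose_mat (Phi_rev L n m)
    = mat (nat (m + 1)) 1 (\<lambda>(r, _). lmono n m * ldagger (phi_row n m r))"
  by (rule eq_matI) (auto simp: Phi_rev_def lmat_dagger_def Phi_eq)

lemma transpose_tPhi_rev_eq: "transpose_mat (tPhi_rev L n m)
    = mat (nat (n + 1)) 1 (\<lambda>(r, _). lmono n m * ldagger (tphi_row n m r))"
  by (rule eq_matI) (auto simp: tPhi_rev_def lmat_dagger_def tPhi_eq)

lemmas vector_eqs = Phi_eq tPhi_eq smult_column transpose_Phi_rev_eq transpose_tPhi_rev_eq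

lemma mat_adjoint_index:
  "i < dim_col A \<Longrightarrow> j < dim_row A \<Longrightarrow> mat_adjoint A $$ (i, j) = conjugate (A $$ (j, i))"
  by (simp add: mat_adjoint_def mat_of_rows_def)

lemma mat_adjoint_dim [simp]: "dim_row (mat_adjoint A) = dim_col A" "dim_col (mat_adjoint A) = dim_row A"
  by (simp_all add: mat_adjoint_def)

lemma gram_adjoint:
  assumes "\<And>r. r < a \<Longrightarrow> f r \<in> lspan_of box" "\<And>s. s < b \<Longrightarrow> g s \<in> lspan_of box"
  shows "mat_adjoint (gram a b f g) = gram b a g f"
proof (rule eq_matI)
  fix i j assume "i < dim_row (gram b a g f)" "j < dim_col (gram b a g f)"
  then have ij: "i < b" "j < a" by (auto simp: gram_def)
  then show "mat_adjoint (gram a b f g) $$ (i, j) = gram b a g f $$ (i, j)"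
    using ip_commute[OF assms(1)[OF ij(2)] assms(2)[OF ij(1)]]
    by (simp add: mat_adjoint_index gram_def)
qed (simp_all add: gram_def)

text \<open>The entry at \<open>(r, s)\<close> is \<open>parseval\<close> for \<open>x r\<close> and
  \<open>x s\<close> in the joined family of \<open>y\<close> and \<open>z\<close>. The inclusion
  \<open>S2 \<subseteq> T1\<close> gives the mutual orthogonality, the other inclusions place the
  joined family between \<open>T\<close> and \<open>S\<close>.\<close>

lemma parseval_gram:
  fixes x y z :: "nat \<Rightarrow> laurent"
  assumes x: "orthonormal_family {..<k} x S T" and y: "orthonormal_family {..<a} y S1 T1"
    and z: "orthonormal_family {..<b} z S2 T2"
    and "T \<subseteq> S" "S \<subseteq> box" "S1 \<subseteq> S" "S2 \<subseteq> S" "T \<subseteq> T1" "T \<subseteq> T2" "S2 \<subseteq> T1"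
    and card: "card S = card T + (a + b)"
  shows "gram k a x y * mat_adjoint (gram k a x y) + gram k b x z * mat_adjoint (gram k b x z) = 1\<^sub>m k"
proof -
  have yz: "orthonormal_family ({..<a} <+> {..<b}) (case_sum y z) S T"
    using assms(4-) by (intro orthonormal_family_mono[OF orthonormal_family_Plus[OF y z]]) auto
  have ip: "(if r = s then 1 else 0) =
      (\<Sum>j<a. ip (x r) (y j) * cnj (ip (x s) (y j))) + (\<Sum>j<b. ip (x r) (z j) * cnj (ip (x s) (z j)))"
    if "r < k" "s < k" for r s
  proof -
    have "ip (x r) (x s) = (if r = s then 1 else 0)"
      "x r \<in> lspan_of S" "x s \<in> lspan_of S" "orth (x r) T"
      using x that unfolding orthonormal_family_def by auto
    then show ?thesis
      using parseval[OF _ yz assms(4,5), of "x r" "x s"] card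
      by (simp add: card_Plus sum.Plus)
  qed
  show ?thesis
  proof (rule eq_matI)
    fix i j assume "i < dim_row (1\<^sub>m k :: complex mat)" "j < dim_col (1\<^sub>m k :: complex mat)"
    then have "i < k" "j < k" by auto
    then show "(gram k a x y * mat_adjoint (gram k a x y) + gram k b x z * mat_adjoint (gram k b x z)) $$ (i, j)
        = 1\<^sub>m k $$ (i, j)"
      by (simp add: gram_def scalar_prod_def mat_adjoint_index ip lessThan_atLeast0)
  qed (simp_all add: gram_def)
qed

section \<open>The coefficient identities\<close>

context
  fixes n m :: int
  assumes n: "0 \<le> n" "n \<le> N" and m: "0 \<le> m" "m \<le> M"
begin

lemma phi_family:
  "orthonormal_family {..<nat (m + 1)} (phi_row n m) ({0..n} \<times> {0..m}) ({0..<n} \<times> {0..m})"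
  using n m by (intro orthonormal_family_phi_row)

lemma tphi_family:
  "orthonormal_family {..<nat (n + 1)} (tphi_row n m) ({0..n} \<times> {0..m}) ({0..n} \<times> {0..<m})"
  using n m by (intro orthonormal_family_tphi_row)

lemma phi_family_pred:
  "orthonormal_family {..<nat m} (phi_row n (m - 1)) ({0..n} \<times> {0..<m}) ({0..<n} \<times> {0..<m})"
proof -
  have "orthonormal_family {..<nat m} (phi_row n (m - 1)) ({0..n} \<times> {0..m - 1}) ({0..<n} \<times> {0..m - 1})"
    using orthonormal_family_phi_row[of n "m - 1"] n m by simp
  then show ?thesis by (rule orthonormal_family_mono) auto
qed

lemma tphi_family_pred:
  "orthonormal_family {..<nat n} (tphi_row (n - 1) m) ({0..<n} \<times> {0..m}) ({0..<n} \<times> {0..<m})"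
proof -
  have "orthonormal_family {..<nat n} (tphi_row (n - 1) m) ({0..n - 1} \<times> {0..m}) ({0..n - 1} \<times> {0..<m})"
    using orthonormal_family_tphi_row[of m "n - 1"] n m by simp
  then show ?thesis by (rule orthonormal_family_mono) auto
qed

lemma phi_row_mem: "r < nat (m + 1) \<Longrightarrow> phi_row n m r \<in> lspan_of box"
  and tphi_row_mem: "r < nat (n + 1) \<Longrightarrow> tphi_row n m r \<in> lspan_of box"
  and phi_row_pred_mem: "r < nat m \<Longrightarrow> phi_row n (m - 1) r \<in> lspan_of box"
  and tphi_row_pred_mem: "r < nat n \<Longrightarrow> tphi_row (n - 1) m r \<in> lspan_of box"
  using n m
  by (auto intro!: orthonormal_family_mem[OF phi_family] orthonormal_family_mem[OF tphi_family]
      orthonormal_family_mem[OF phi_family_pred] orthonormal_family_mem[OF tphi_family_pred])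

lemma coeff_A_gram: "coeff_A L n m
    = gram (nat (m + 1)) (nat (m + 1)) (\<lambda>r. lmono 1 0 * phi_row (n - 1) m r) (phi_row n m)"
  by (simp only: coeff_A_def vector_eqs linner_eq_gram)

lemma coeff_Ehat_gram: "coeff_Ehat L n m
    = gram (nat (m + 1)) (nat (m + 1)) (\<lambda>r. lmono 1 0 * phi_row (n - 1) m r)
        (\<lambda>r. lmono (n - 1) m * ldagger (phi_row (n - 1) m r))"
  by (simp only: coeff_Ehat_def vector_eqs linner_eq_gram)

lemma coeff_K_gram: "coeff_K L n m = gram (nat m) (nat n) (phi_row n (m - 1)) (tphi_row (n - 1) m)"
  by (simp only: coeff_K_def vector_eqs linner_eq_gram diff_add_cancel)

lemma coeff_Gamma_gram: "coeff_Gamma L n m = gram (nat m) (nat (m + 1)) (phi_row n (m - 1)) (phi_row n m)"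
  by (simp only: coeff_Gamma_def vector_eqs linner_eq_gram diff_add_cancel)

lemma coeff_K1_gram: "coeff_K1 L n m
    = gram (nat m) (nat n) (\<lambda>r. lmono 0 1 * phi_row n (m - 1) r)
        (\<lambda>r. lmono (n - 1) m * ldagger (tphi_row (n - 1) m r))"
  by (simp only: coeff_K1_def vector_eqs linner_eq_gram diff_add_cancel)

lemma coeff_Gamma1_gram: "coeff_Gamma1 L n m
    = gram (nat m) (nat (m + 1)) (\<lambda>r. lmono 0 1 * phi_row n (m - 1) r) (phi_row n m)"
  by (simp only: coeff_Gamma1_def vector_eqs linner_eq_gram diff_add_cancel)

lemma coeff_I_gram: "coeff_I L n m = gram (nat (m + 1)) (nat (n + 1)) (phi_row n m) (tphi_row n m)"
  by (simp only: coeff_I_def vector_eqs linner_eq_gram)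

lemma coeff_I1_gram: "coeff_I1 L n m
    = gram (nat (m + 1)) (nat (n + 1)) (\<lambda>r. lmono n m * ldagger (phi_row n m r)) (tphi_row n m)"
  by (simp only: coeff_I1_def vector_eqs linner_eq_gram)

section \<open>Adjoint and transpose relations between the two orderings\<close>

lemma coeff_tK_eq: "coeff_tK L n m = mat_adjoint (coeff_K L n m)"
  by (simp only: coeff_tK_def vector_eqs linner_eq_gram diff_add_cancel coeff_K_gram
      gram_adjoint phi_row_pred_mem tphi_row_pred_mem)

lemma coeff_tI_eq: "coeff_tI L n m = mat_adjoint (coeff_I L n m)"
  by (simp only: coeff_tI_def vector_eqs linner_eq_gram coeff_I_gram
      gram_adjoint phi_row_mem tphi_row_mem)

text \<open>With one factor reversed, the argument of \<open>L\<close> is a monomial times the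
  daggers of both polynomials, hence symmetric in them. This gives a transpose rather than an
  adjoint.\<close>

lemma coeff_tI1_eq: "coeff_tI1 L n m = transpose_mat (coeff_I1 L n m)"
  unfolding coeff_tI1_def vector_eqs linner_eq_gram coeff_I1_gram
  by (rule eq_matI) (auto simp: gram_def ip_def mult_ac)

lemma coeff_tK1_eq: "coeff_tK1 L n m = transpose_mat (coeff_K1 L n m)"
proof -
  \<comment> \<open>Both sides equal \<open>lmono (1 - n) (1 - m) * (p * q)\<close>.\<close>
  have "lmono 1 0 * p * ldagger (lmono n (m - 1) * ldagger q)
      = lmono 0 1 * q * ldagger (lmono (n - 1) m * ldagger p)" for p q
  proof -
    have "lmono 1 0 * p * ldagger (lmono n (m - 1) * ldagger q)
        = lmono 1 0 * lmono (- n) (1 - m) * (p * q)"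
      by (simp add: ldagger_mult mult_ac)
    also have "\<dots> = lmono 0 1 * lmono (1 - n) (- m) * (p * q)"
      by (simp add: lmono_mult)
    also have "\<dots> = lmono 0 1 * q * ldagger (lmono (n - 1) m * ldagger p)"
      by (simp add: ldagger_mult mult_ac)
    finally show ?thesis .
  qed
  then show ?thesis
    unfolding coeff_tK1_def vector_eqs linner_eq_gram diff_add_cancel coeff_K1_gram
    by (intro eq_matI) (auto simp: gram_def ip_def)
qed

section \<open>The five Parseval identities\<close>

lemma card_rectangle: "card ({0..n} \<times> {0..m}) = nat n * nat m + (nat n + nat m + 1)"
  using n m by (simp add: card_cartesian_product nat_add_distrib)

text \<open>The shift by \<open>z\<close> and the reversal of \<open>Phi L (n - 1) m\<close> are
  both orthogonal to the inner columns \<open>{1..<n}\<close>; \<open>Phi L n m\<close> is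
  orthogonal to all columns below \<open>n\<close>, where the reversal lives. Two columns, that is
  \<open>2 * (m + 1)\<close> dimensions, remain.\<close>

lemma A_identity:
  assumes "n \<ge> 1"
  shows "coeff_A L n m * mat_adjoint (coeff_A L n m)
    + coeff_Ehat L n m * mat_adjoint (coeff_Ehat L n m) = 1\<^sub>m (nat (m + 1))"
  unfolding coeff_A_gram coeff_Ehat_gram
proof (rule parseval_gram[where S = "{0..n} \<times> {0..m}" and T = "{1..<n} \<times> {0..m}", OF _ phi_family])
  have f: "orthonormal_family {..<nat (m + 1)} (phi_row (n - 1) m)
      ({0..n - 1} \<times> {0..m}) ({0..<n - 1} \<times> {0..m})"
    using n m assms by (intro orthonormal_family_phi_row) auto
  show "orthonormal_family {..<nat (m + 1)} (\<lambda>r. lmono 1 0 * phi_row (n - 1) m r)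
      ({0..n} \<times> {0..m}) ({1..<n} \<times> {0..m})"
    by (rule orthonormal_family_shift[OF f]) (use n m in auto)
  show "orthonormal_family {..<nat (m + 1)} (\<lambda>r. lmono (n - 1) m * ldagger (phi_row (n - 1) m r))
      ({0..<n} \<times> {0..m}) ({1..<n} \<times> {0..m})"
    by (rule orthonormal_family_reverse[OF f]) (use n m in auto)
  \<comment> \<open>Writing \<open>n\<close> as a successor avoids truncated subtraction in the
    cardinality of \<open>{1..<n}\<close>.\<close>
  obtain k where "n = int k + 1" using assms by (metis add.commute zle_iff_zadd)
  then show "card ({0..n} \<times> {0..m}) = card ({1..<n} \<times> {0..m}) + (nat (m + 1) + nat (m + 1))"
    using m by (simp add: card_cartesian_product nat_add_distrib)
qed (use n m in auto)

text \<open>\<open>Phi L n m\<close> is orthogonal to the columns below \<open>n\<close>, which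
  contain \<open>tPhi L (n - 1) m\<close>. Their \<open>m + 1\<close> and \<open>n\<close> members
  fill the complement of the \<open>n\<close> by \<open>m\<close> block, as
  \<open>card_rectangle\<close> displays.\<close>

lemma Gamma_identity:
  "coeff_Gamma L n m * mat_adjoint (coeff_Gamma L n m)
    + coeff_K L n m * mat_adjoint (coeff_K L n m) = 1\<^sub>m (nat m)"
  unfolding coeff_Gamma_gram coeff_K_gram
proof (rule parseval_gram[where S = "{0..n} \<times> {0..m}" and T = "{0..<n} \<times> {0..<m}",
      OF _ phi_family tphi_family_pred])
  show "orthonormal_family {..<nat m} (phi_row n (m - 1)) ({0..n} \<times> {0..m}) ({0..<n} \<times> {0..<m})"
    by (rule orthonormal_family_mono[OF phi_family_pred]) auto
qed (use n m in \<open>auto simp: card_rectangle card_cartesian_product nat_add_distrib\<close>)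

text \<open>Shifting \<open>Phi L n (m - 1)\<close> by \<open>w\<close> and reversing
  \<open>tPhi L (n - 1) m\<close> both move the orthogonality block up to the rows
  \<open>{1..m}\<close>, so the count is that of \<open>Gamma_identity\<close>.\<close>

lemma Gamma1_identity:
  "coeff_Gamma1 L n m * mat_adjoint (coeff_Gamma1 L n m)
    + coeff_K1 L n m * mat_adjoint (coeff_K1 L n m) = 1\<^sub>m (nat m)"
  unfolding coeff_Gamma1_gram coeff_K1_gram
proof (rule parseval_gram[where S = "{0..n} \<times> {0..m}" and T = "{0..<n} \<times> {1..m}", OF _ phi_family])
  show "orthonormal_family {..<nat m} (\<lambda>r. lmono 0 1 * phi_row n (m - 1) r)
      ({0..n} \<times> {0..m}) ({0..<n} \<times> {1..m})"
    by (rule orthonormal_family_shift[OF phi_family_pred]) (use n m in auto)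
  show "orthonormal_family {..<nat n} (\<lambda>r. lmono (n - 1) m * ldagger (tphi_row (n - 1) m r))
      ({0..<n} \<times> {0..m}) ({0..<n} \<times> {1..m})"
    by (rule orthonormal_family_reverse[OF tphi_family_pred]) (use n m in auto)
qed (use n m in \<open>auto simp: card_rectangle card_cartesian_product nat_add_distrib\<close>)

text \<open>Now \<open>Phi L n m\<close> is expanded in \<open>tPhi L n m\<close> and
  \<open>Phi L n (m - 1)\<close>; the former is orthogonal to the rows below \<open>m\<close>, where
  the latter lives.\<close>

lemma I_identity:
  "coeff_I L n m * mat_adjoint (coeff_I L n m)
    + mat_adjoint (coeff_Gamma L n m) * coeff_Gamma L n m = 1\<^sub>m (nat (m + 1))"
proof -
  let ?G = "gram (nat (m + 1)) (nat m) (phi_row n m) (phi_row n (m - 1))"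
  have "mat_adjoint (coeff_Gamma L n m) = ?G" "coeff_Gamma L n m = mat_adjoint ?G"
    unfolding coeff_Gamma_gram by (simp_all only: gram_adjoint phi_row_mem phi_row_pred_mem)
  moreover have "coeff_I L n m * mat_adjoint (coeff_I L n m) + ?G * mat_adjoint ?G = 1\<^sub>m (nat (m + 1))"
    unfolding coeff_I_gram
  proof (rule parseval_gram[where S = "{0..n} \<times> {0..m}" and T = "{0..<n} \<times> {0..<m}",
        OF _ tphi_family phi_family_pred])
    show "orthonormal_family {..<nat (m + 1)} (phi_row n m) ({0..n} \<times> {0..m}) ({0..<n} \<times> {0..<m})"
      by (rule orthonormal_family_mono[OF phi_family]) auto
  qed (use n m in \<open>auto simp: card_rectangle card_cartesian_product nat_add_distrib\<close>)
  ultimately show ?thesis by (simp only:)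
qed

text \<open>The reversal of \<open>Phi L n m\<close> is expanded in \<open>tPhi L n m\<close> and
  the reversal of \<open>Phi L n (m - 1)\<close>. Reflection moves the common orthogonality block to
  \<open>{1..n} \<times> {0..<m}\<close>.\<close>

lemma I1_identity:
  "coeff_I1 L n m * mat_adjoint (coeff_I1 L n m)
    + transpose_mat (coeff_Gamma1 L n m) * map_mat cnj (coeff_Gamma1 L n m) = 1\<^sub>m (nat (m + 1))"
proof -
  let ?G = "gram (nat (m + 1)) (nat m) (\<lambda>r. lmono n m * ldagger (phi_row n m r))
    (\<lambda>r. lmono n (m - 1) * ldagger (phi_row n (m - 1) r))"
  \<comment> \<open>The reversal exponents differ by one power of \<open>w\<close>, which is the
    factor in \<open>coeff_Gamma1\<close>; since reversal swaps arguments, its transpose is the Gram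
    matrix \<open>?G\<close>.\<close>
  have "lmono n m * p * ldagger (lmono n (m - 1) * q) = lmono 0 1 * ldagger q * p" for p q
  proof -
    have "lmono n m * p * ldagger (lmono n (m - 1) * q)
        = lmono n m * lmono (- n) (1 - m) * (p * ldagger q)"
      by (simp add: ldagger_mult mult_ac)
    also have "\<dots> = lmono 0 1 * ldagger q * p"
      by (simp add: lmono_mult mult_ac)
    finally show ?thesis .
  qed
  then have "transpose_mat (coeff_Gamma1 L n m) = ?G"
    unfolding coeff_Gamma1_gram by (intro eq_matI) (auto simp: gram_def ip_def)
  moreover have "map_mat cnj A = mat_adjoint (transpose_mat A)" for A
    by (rule eq_matI) (auto simp: mat_adjoint_index)
  moreover have "coeff_I1 L n m * mat_adjoint (coeff_I1 L n m) + ?G * mat_adjoint ?G = 1\<^sub>m (nat (m + 1))"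
    unfolding coeff_I1_gram
  proof (rule parseval_gram[where S = "{0..n} \<times> {0..m}" and T = "{1..n} \<times> {0..<m}", OF _ tphi_family])
    show "orthonormal_family {..<nat (m + 1)} (\<lambda>r. lmono n m * ldagger (phi_row n m r))
        ({0..n} \<times> {0..m}) ({1..n} \<times> {0..<m})"
      by (rule orthonormal_family_reverse[OF phi_family]) (use n m in auto)
    show "orthonormal_family {..<nat m} (\<lambda>r. lmono n (m - 1) * ldagger (phi_row n (m - 1) r))
        ({0..n} \<times> {0..<m}) ({1..n} \<times> {0..<m})"
      by (rule orthonormal_family_reverse[OF phi_family_pred]) (use n m in auto)
  qed (use n m in \<open>auto simp: card_rectangle card_cartesian_product nat_add_distrib\<close>)
  ultimately show ?thesis by (simp only:)
qed

end

end

text \<open>Parseval yields sums; three of the claims are stated as differences.\<close>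

lemma mat_eq_diffI:
  fixes P Q R :: "'a::ab_group_add mat"
  assumes "P + Q = R" "P \<in> carrier_mat k k" "Q \<in> carrier_mat k k"
  shows "P = R - Q"
  unfolding assms(1)[symmetric] using assms(2,3) by (intro eq_matI) auto

theorem proposition3p7:
  fixes L :: "laurent \<Rightarrow> complex" and N M n m :: int
  assumes "pos_def_functional N M L"
    and "0 \<le> n" "n \<le> N" "0 \<le> m" "m \<le> M"
  shows "coeff_tK L n m = mat_adjoint (coeff_K L n m)
    \<and> coeff_tI L n m = mat_adjoint (coeff_I L n m)
    \<and> coeff_tI1 L n m = transpose_mat (coeff_I1 L n m)
    \<and> coeff_tK1 L n m = transpose_mat (coeff_K1 L n m)
    \<and> (n \<ge> 1 \<longrightarrow> coeff_A L n m * mat_adjoint (coeff_A L n m)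
          = 1\<^sub>m (nat (m + 1)) - coeff_Ehat L n m * mat_adjoint (coeff_Ehat L n m))
    \<and> coeff_Gamma L n m * mat_adjoint (coeff_Gamma L n m)
          = 1\<^sub>m (nat m) - coeff_K L n m * mat_adjoint (coeff_K L n m)
    \<and> coeff_Gamma1 L n m * mat_adjoint (coeff_Gamma1 L n m)
          = 1\<^sub>m (nat m) - coeff_K1 L n m * mat_adjoint (coeff_K1 L n m)
    \<and> coeff_I L n m * mat_adjoint (coeff_I L n m)
          + mat_adjoint (coeff_Gamma L n m) * coeff_Gamma L n m = 1\<^sub>m (nat (m + 1))
    \<and> coeff_I1 L n m * mat_adjoint (coeff_I1 L n m)
          + transpose_mat (coeff_Gamma1 L n m) * map_mat cnj (coeff_Gamma1 L n m)
        = 1\<^sub>m (nat (m + 1))"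
proof -
  interpret pos_def_laurent L N M by unfold_locales fact
  have adjoint: "A * mat_adjoint A \<in> carrier_mat k k" if "A \<in> carrier_mat k l" for A :: "complex mat" and k l
    using that by (auto intro!: carrier_matI)
  have carriers:
    "coeff_A L n m \<in> carrier_mat (nat (m + 1)) (nat (m + 1))"
    "coeff_Ehat L n m \<in> carrier_mat (nat (m + 1)) (nat (m + 1))"
    "coeff_Gamma L n m \<in> carrier_mat (nat m) (nat (m + 1))"
    "coeff_K L n m \<in> carrier_mat (nat m) (nat n)"
    "coeff_Gamma1 L n m \<in> carrier_mat (nat m) (nat (m + 1))"
    "coeff_K1 L n m \<in> carrier_mat (nat m) (nat n)"
    using assms(2-5)
    by (simp_all only: coeff_A_gram coeff_Ehat_gram coeff_Gamma_gram coeff_K_gram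
        coeff_Gamma1_gram coeff_K1_gram gram_carrier)
  show ?thesis
    using assms(2-5) carriers[THEN adjoint]
    by (intro conjI impI coeff_tK_eq coeff_tI_eq coeff_tI1_eq coeff_tK1_eq I_identity I1_identity
        mat_eq_diffI A_identity Gamma_identity Gamma1_identity)
qed

end
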